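(* Let $n$ be a positive integer and let $\mathcal{P}_n^{\Box}$ be the set of pseudo magic squares of order $n$. Then the ordered pair $(\mathcal{P}_n^{\Box}, +)$, where $+$ is the addition of matrices, is an abelian group.
   Context: $\mathbb{M}_n(\mathbb{Z})$ denotes the set of $n\times n$ matrices with integer entries. A pseudo magic square of order $n$ (with $n$ a positive integer) is a matrix $A \in \mathbb{M}_n(\mathbb{Z})$ such that the sum of the entries of every row and of every column is one and the same integer $c_A$ (its pseudo magic constant). Entries need not be distinct, and no condition is imposed on the diagonals. *)

theory Defs
  imports "Jordan_Normal_Form.Matrix"
begin

definition has_pseudo_magic_constant :: "int mat \<Rightarrow> int \<Rightarrow> bool" where
  "has_pseudo_magic_constant A c \<longleftrightarrow>
     (\<forall>i < dim_row A. (\<Sum>j < dim_col A. A $$ (i, j)) = c) \<and>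
     (\<forall>j < dim_col A. (\<Sum>i < dim_row A. A $$ (i, j)) = c)"

definition pseudo_magic_squares :: "nat \<Rightarrow> int mat set" where
  "pseudo_magic_squares n = {A \<in> carrier_mat n n. \<exists>c. has_pseudo_magic_constant A c}"

text \<open>
  Group records in HOL-Algebra are written multiplicatively, so matrix addition is the
  \<open>mult\<close> field. They also carry the neutral element as data; here it is the zero matrix.
\<close>
definition pseudo_magic_group :: "nat \<Rightarrow> int mat monoid" where
  "pseudo_magic_group n =
     \<lparr>carrier = pseudo_magic_squares n, mult = (+), one = 0\<^sub>m n n\<rparr>"

end

theory Submission
  imports Defs
begin

text \<open>Pseudo magic squares form a subgroup of the abelian group of n by n integer matrices.
  Each row or column sum is an additive map, so zero, sums and negatives of squares with constants a
  and b again have constant line sums: 0, a + b and -a. The three closure lemmas record this; the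
  group laws are inherited from matrix addition.\<close>

lemma zero_in_pseudo_magic_squares: "0\<^sub>m n n \<in> pseudo_magic_squares n"
  by (auto simp: pseudo_magic_squares_def has_pseudo_magic_constant_def)

lemma add_in_pseudo_magic_squares:
  assumes "A \<in> pseudo_magic_squares n" "B \<in> pseudo_magic_squares n"
  shows "A + B \<in> pseudo_magic_squares n"
proof -
  obtain a b where
    "A \<in> carrier_mat n n" "has_pseudo_magic_constant A a"
    "B \<in> carrier_mat n n" "has_pseudo_magic_constant B b"
    using assms by (auto simp: pseudo_magic_squares_def)
  \<comment> \<open>The common size n by n keeps all summed indices in range for both matrices, so
    each line sum splits entrywise.\<close>
  then have "A + B \<in> carrier_mat n n" "has_pseudo_magic_constant (A + B) (a + b)"
    by (auto simp: has_pseudo_magic_constant_def sum.distrib)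
  then show ?thesis
    by (auto simp: pseudo_magic_squares_def)
qed

lemma uminus_in_pseudo_magic_squares:
  assumes "A \<in> pseudo_magic_squares n"
  shows "- A \<in> pseudo_magic_squares n"
proof -
  obtain a where "A \<in> carrier_mat n n" "has_pseudo_magic_constant A a"
    using assms by (auto simp: pseudo_magic_squares_def)
  then have "- A \<in> carrier_mat n n" "has_pseudo_magic_constant (- A) (- a)"
    by (auto simp: has_pseudo_magic_constant_def sum_negf)
  then show ?thesis
    by (auto simp: pseudo_magic_squares_def)
qed

theorem theorem3p1:
  fixes n :: nat
  assumes "n > 0"
  shows "comm_group (pseudo_magic_group n)"
proof -
  have carrier: "A \<in> carrier_mat n n" if "A \<in> pseudo_magic_squares n" for A
    using that by (simp add: pseudo_magic_squares_def)
  show ?thesis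
  \<comment> \<open>With commutativity among its premises, \<open>comm_groupI\<close> asks only for
    a left unit and left inverses.\<close>
  proof (rule comm_groupI, unfold pseudo_magic_group_def monoid.simps partial_object.simps)
    fix A B C
    assume A: "A \<in> pseudo_magic_squares n" and B: "B \<in> pseudo_magic_squares n"
    show "A + B \<in> pseudo_magic_squares n"
      using A B by (rule add_in_pseudo_magic_squares)
    show "A + B = B + A"
      using A B by (rule comm_add_mat[OF carrier carrier])
    assume "C \<in> pseudo_magic_squares n"
    with A B show "A + B + C = A + (B + C)"
      by (intro assoc_add_mat[OF carrier carrier carrier])
  next
    show "0\<^sub>m n n \<in> pseudo_magic_squares n"
      by (rule zero_in_pseudo_magic_squares)
  next
    fix A
    assume A: "A \<in> pseudo_magic_squares n"
    then show "0\<^sub>m n n + A = A"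
      by (intro left_add_zero_mat carrier)
    \<comment> \<open>The witness is \<open>- A\<close>, a pseudo magic square with the negated
      constant.\<close>
    show "\<exists>B\<in>pseudo_magic_squares n. B + A = 0\<^sub>m n n"
      using uminus_in_pseudo_magic_squares[OF A] uminus_l_inv_mat[OF carrier[OF A]] by blast
  qed
qed

end
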